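(* Let $K$ be a field with $\mathrm{char}(K)\ne2,3$, $\Delta\in K^*$, and $g_1,g_2$ binary cubic forms over $K$ of discriminant $\Delta$, with common resolvent algebra $L=K[\delta]$. Then: (1) $g_2=g_1^M$ for some $M\in\mathrm{GL}(2,K)$ with $\det(M)=+1$ if and only if $z(g_1)=z(g_2)$ in $L^*/L^{*3}$; (2) $g_2=g_1^M$ for some $M\in\mathrm{GL}(2,K)$ with $\det(M)=-1$ if and only if $z(g_1)=z(g_2)^{-1}$ in $L^*/L^{*3}$. Hence $g_1$ and $g_2$ are $\mathrm{GL}(2,K)$-equivalent if and only if $z(g_1)$ and $z(g_2)$ generate the same subgroup of $L^*/L^{*3}$.
   Context: For $g=aX^3+bX^2Y+cXY^2+dY^3$: discriminant $b^2c^2-4ac^3-4b^3d-27a^2d^2+18abcd$; cubic covariant $G(X,Y)=(2b^3+27a^2d-9abc)X^3+3(b^2c+9abd-6ac^2)X^2Y-3(bc^2+9acd-6b^2d)XY^2-(2c^3+27ad^2-9bcd)Y^3$. Twisted action: $g^M(X,Y)=\det(M)^{-1}g(rX+tY,sX+uY)$ for $M=\begin{pmatrix}r&s\\t&u\end{pmatrix}$. Resolvent algebra $L=K[T]/(T^2+3\Delta)$, $\delta$ the image of $T$ (fixed for all forms of discriminant $\Delta$), $L^*$ its unit group. Cardano covariant $C=\tfrac12(G+3\delta g)$; Cardano invariant $z(g)$ = class in $L^*/L^{*3}$ of $C(x,y)$ for any $x,y\in K$ with $C(x,y)\in L^*$ (independent of the choice). *)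

theory Defs
  imports
    "HOL-Analysis.Analysis"
    "HOL-Algebra.Algebra"
    "HOL-Algebra.Algebraic_Closure_Type"
begin

text \<open>\<open>BCF a b c d\<close> is the form \<open>a X\<^sup>3 + b X\<^sup>2 Y + c X Y\<^sup>2 + d Y\<^sup>3\<close>, given by its
  coefficients.\<close>

datatype 'a bcf = BCF 'a 'a 'a 'a

fun bcf_eval :: "'a::comm_ring_1 bcf \<Rightarrow> 'a \<Rightarrow> 'a \<Rightarrow> 'a" where
  "bcf_eval (BCF a b c d) x y = a * x ^ 3 + b * x ^ 2 * y + c * x * y ^ 2 + d * y ^ 3"

fun bcf_disc :: "'a::comm_ring_1 bcf \<Rightarrow> 'a" where
  "bcf_disc (BCF a b c d) =
     b ^ 2 * c ^ 2 - 4 * a * c ^ 3 - 4 * b ^ 3 * d - 27 * a ^ 2 * d ^ 2 + 18 * a * b * c * d"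

fun cubic_covariant :: "'a::comm_ring_1 bcf \<Rightarrow> 'a bcf" where
  "cubic_covariant (BCF a b c d) =
     BCF (2 * b ^ 3 + 27 * a ^ 2 * d - 9 * a * b * c)
         (3 * (b ^ 2 * c + 9 * a * b * d - 6 * a * c ^ 2))
         (- 3 * (b * c ^ 2 + 9 * a * c * d - 6 * b ^ 2 * d))
         (- (2 * c ^ 3 + 27 * a * d ^ 2 - 9 * b * c * d))"

text \<open>Coefficients of \<open>g(rX + tY, sX + uY)\<close>; lemma \<open>bcf_poly_twist\<close> below confirms the
  expansion as an identity of polynomials in \<open>X\<close> and \<open>Y\<close>.\<close>

fun bcf_subst :: "'a::comm_ring_1 bcf \<Rightarrow> 'a \<Rightarrow> 'a \<Rightarrow> 'a \<Rightarrow> 'a \<Rightarrow> 'a bcf" where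
  "bcf_subst (BCF a b c d) r s t u =
     BCF (a * r ^ 3 + b * r ^ 2 * s + c * r * s ^ 2 + d * s ^ 3)
         (3 * a * r ^ 2 * t + b * (r ^ 2 * u + 2 * r * s * t)
            + c * (2 * r * s * u + s ^ 2 * t) + 3 * d * s ^ 2 * u)
         (3 * a * r * t ^ 2 + b * (2 * r * t * u + s * t ^ 2)
            + c * (r * u ^ 2 + 2 * s * t * u) + 3 * d * s * u ^ 2)
         (a * t ^ 3 + b * t ^ 2 * u + c * t * u ^ 2 + d * u ^ 3)"

definition bcf_twist :: "'a::field bcf \<Rightarrow> 'a ^ 2 ^ 2 \<Rightarrow> 'a bcf" where
  "bcf_twist g M = map_bcf (\<lambda>k. inverse (det M) * k)
     (bcf_subst g (M $ 1 $ 1) (M $ 1 $ 2) (M $ 2 $ 1) (M $ 2 $ 2))"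

text \<open>Forms as elements of \<open>K[X][Y]\<close>, used only to validate \<open>bcf_twist\<close>.\<close>

abbreviation bcf_const :: "'a::comm_ring_1 \<Rightarrow> 'a poly poly" where
  "bcf_const k \<equiv> [:[:k:]:]"

abbreviation bcf_X :: "'a::comm_ring_1 poly poly" where
  "bcf_X \<equiv> [:[:0, 1:]:]"

abbreviation bcf_Y :: "'a::comm_ring_1 poly poly" where
  "bcf_Y \<equiv> [:0, 1:]"

definition bcf_poly :: "'a::comm_ring_1 bcf \<Rightarrow> 'a poly poly" where
  "bcf_poly g = bcf_eval (map_bcf bcf_const g) bcf_X bcf_Y"

lemma bcf_poly_inj: "bcf_poly g = bcf_poly h \<longleftrightarrow> g = h"
  by (cases g; cases h) (auto simp: bcf_poly_def numeral_eq_Suc)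

lemma bcf_poly_twist:
  fixes g :: "'a::field bcf"
  shows "bcf_poly (bcf_twist g M) =
    bcf_const (inverse (det M)) *
    bcf_eval (map_bcf bcf_const g)
      (bcf_const (M $ 1 $ 1) * bcf_X + bcf_const (M $ 2 $ 1) * bcf_Y)
      (bcf_const (M $ 1 $ 2) * bcf_X + bcf_const (M $ 2 $ 2) * bcf_Y)"
  by (cases g) (simp add: bcf_poly_def bcf_twist_def numeral_eq_Suc algebra_simps)

text \<open>The resolvent algebra \<open>K[T]/(T\<^sup>2 + 3\<Delta>)\<close>, as a quotient of the polynomial ring
  over \<open>K\<close>.\<close>

abbreviation resolvent_ideal :: "'a::field \<Rightarrow> 'a poly set" where
  "resolvent_ideal \<Delta> \<equiv> PIdl\<^bsub>ring_of_type_algebra\<^esub> [:3 * \<Delta>, 0, 1:]"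

definition resolvent_algebra :: "'a::field \<Rightarrow> 'a poly set ring" where
  "resolvent_algebra \<Delta> = ring_of_type_algebra Quot resolvent_ideal \<Delta>"

definition resolvent_class :: "'a::field \<Rightarrow> 'a poly \<Rightarrow> 'a poly set" where
  "resolvent_class \<Delta> p = resolvent_ideal \<Delta> +>\<^bsub>ring_of_type_algebra\<^esub> p"

definition resolvent_const :: "'a::field \<Rightarrow> 'a \<Rightarrow> 'a poly set" where
  "resolvent_const \<Delta> k = resolvent_class \<Delta> [:k:]"

definition resolvent_delta :: "'a::field \<Rightarrow> 'a poly set" where
  "resolvent_delta \<Delta> = resolvent_class \<Delta> [:0, 1:]"

text \<open>The value at \<open>(x, y) \<in> K\<^sup>2\<close> of the Cardano covariant \<open>(G + 3\<delta>g)/2\<close>.\<close>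

definition cardano_covariant :: "'a::field \<Rightarrow> 'a bcf \<Rightarrow> 'a \<Rightarrow> 'a \<Rightarrow> 'a poly set" where
  "cardano_covariant \<Delta> g x y =
     (let L = resolvent_algebra \<Delta> in
      resolvent_const \<Delta> (1 / 2) \<otimes>\<^bsub>L\<^esub>
        (resolvent_const \<Delta> (bcf_eval (cubic_covariant g) x y) \<oplus>\<^bsub>L\<^esub>
         resolvent_const \<Delta> 3 \<otimes>\<^bsub>L\<^esub> resolvent_delta \<Delta> \<otimes>\<^bsub>L\<^esub>
           resolvent_const \<Delta> (bcf_eval g x y)))"

definition resolvent_units :: "'a::field \<Rightarrow> 'a poly set monoid" where
  "resolvent_units \<Delta> = units_of (resolvent_algebra \<Delta>)"

definition resolvent_cubes :: "'a::field \<Rightarrow> 'a poly set set" where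
  "resolvent_cubes \<Delta> =
     (\<lambda>w. w [^]\<^bsub>resolvent_units \<Delta>\<^esub> (3::nat)) ` carrier (resolvent_units \<Delta>)"

definition units_mod_cubes :: "'a::field \<Rightarrow> 'a poly set set monoid" where
  "units_mod_cubes \<Delta> = resolvent_units \<Delta> Mod resolvent_cubes \<Delta>"

definition cardano_invariant :: "'a::field \<Rightarrow> 'a bcf \<Rightarrow> 'a poly set set" where
  "cardano_invariant \<Delta> g =
     (THE \<zeta>. \<exists>x y. cardano_covariant \<Delta> g x y \<in> carrier (resolvent_units \<Delta>) \<and>
        \<zeta> = resolvent_cubes \<Delta> #>\<^bsub>resolvent_units \<Delta>\<^esub> cardano_covariant \<Delta> g x y)"

end

theory Submission
  imports Defs
begin

text \<open>
  Let \<open>H\<close> be the Hessian of \<open>g\<close>. The syzygy \<open>G\<^sup>2 + 27 \<Delta> g\<^sup>2 = 4 H\<^sup>3\<close> says that the Cardano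
  covariant \<open>C\<close> has norm \<open>H\<^sup>3\<close>; polarising it shows that \<open>C(v) C\<^sup>*(w)\<close> (with \<open>\<^sup>*\<close> the conjugation
  of \<open>L\<close>) is a cube for all \<open>v, w\<close>, so that the class of \<open>C(v)\<close> does not depend on \<open>v\<close>. A twist by
  a matrix of determinant \<open>1\<close> or \<open>-1\<close> replaces \<open>C\<close> by \<open>C \<circ> M\<close> or its conjugate, and the conjugate
  represents the inverse class because the norm is a cube.

  Conversely, if \<open>H(v) \<noteq> 0\<close>, then a twist by \<open>SL\<^sub>2\<close> taking \<open>v\<close> to \<open>(1, 0)\<close> and diagonalising \<open>H\<close>
  brings \<open>C\<close> into the form \<open>z (X + \<delta> Y / (2 h))\<^sup>3\<close> with \<open>z = C(v)\<close> and \<open>h = H(v)\<close>. If two such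
  forms satisfy \<open>z\<^sub>1 = w\<^sup>3 z\<^sub>2\<close>, then \<open>h\<^sub>1\<^sup>3 = N(w)\<^sup>3 h\<^sub>2\<^sup>3\<close>, and \<open>w\<close> can be multiplied by a cube root
  of unity in \<open>K\<close> so that \<open>h\<^sub>1 = N(w) h\<^sub>2\<close>. Multiplication by \<open>w\<close> on \<open>L = K\<^sup>2\<close> then gives the matrix
  of determinant \<open>1\<close> that relates them.
\<close>

section \<open>Covariants, syzygies and the twisted action\<close>

text \<open>This is -1/4 times the determinant of the matrix of second partial derivatives of
  \<open>g\<close>.\<close>

definition hessian_form :: "'a::field bcf \<Rightarrow> 'a \<Rightarrow> 'a \<Rightarrow> 'a" where
  "hessian_form g x y = (case g of BCF a b c d \<Rightarrow>
     (b ^ 2 - 3 * a * c) * x ^ 2 + (b * c - 9 * a * d) * x * y + (c ^ 2 - 3 * b * d) * y ^ 2)"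

lemma cubic_syzygy:
  fixes g :: "'a::field bcf"
  shows "bcf_eval (cubic_covariant g) x y ^ 2 + 27 * bcf_disc g * bcf_eval g x y ^ 2
     = 4 * hessian_form g x y ^ 3"
  by (induction g) (simp add: hessian_form_def, Groebner_Basis.algebra)

text \<open>With \<open>B = (m + n \<delta>) / 2\<close> this says \<open>C(x, y) C\<^sup>*(x', y') = B\<^sup>3\<close>, where \<open>C\<^sup>*\<close> is the
  conjugate of the Cardano covariant, split into its two coordinates with respect to \<open>1, \<delta>\<close>.\<close>

lemma cubic_syzygy_polarised:
  fixes g :: "'a::field bcf"
  assumes "g = BCF a b c d"
    and "m = 2 * (b ^ 2 - 3 * a * c) * x * x' + (b * c - 9 * a * d) * (x * y' + x' * y)
      + 2 * (c ^ 2 - 3 * b * d) * y * y'"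
    and "n = x' * y - x * y'"
  shows "2 * (bcf_eval (cubic_covariant g) x y * bcf_eval (cubic_covariant g) x' y'
            + 27 * bcf_disc g * bcf_eval g x y * bcf_eval g x' y')
           = m ^ 3 - 9 * bcf_disc g * m * n ^ 2"
    and "2 * (bcf_eval g x y * bcf_eval (cubic_covariant g) x' y'
            - bcf_eval (cubic_covariant g) x y * bcf_eval g x' y')
           = m ^ 2 * n - bcf_disc g * n ^ 3"
  unfolding assms by (simp, Groebner_Basis.algebra)+

lemma cubic_covariant_subst:
  fixes g :: "'a::field bcf"
  shows "cubic_covariant (bcf_subst g r s t u) =
     map_bcf (\<lambda>k. (r * u - s * t) ^ 3 * k) (bcf_subst (cubic_covariant g) r s t u)"
  by (induction g) (simp, intro conjI; Groebner_Basis.algebra)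

lemma bcf_disc_subst:
  fixes g :: "'a::field bcf"
  shows "bcf_disc (bcf_subst g r s t u) = (r * u - s * t) ^ 6 * bcf_disc g"
  by (induction g) (simp, Groebner_Basis.algebra)

lemma bcf_subst_subst:
  fixes g :: "'a::field bcf"
  shows "bcf_subst (bcf_subst g r s t u) r' s' t' u' =
     bcf_subst g (r' * r + s' * t) (r' * s + s' * u) (t' * r + u' * t) (t' * s + u' * u)"
  by (induction g) (simp, intro conjI; Groebner_Basis.algebra)

lemma bcf_eval_subst:
  fixes g :: "'a::field bcf"
  shows "bcf_eval (bcf_subst g r s t u) x y = bcf_eval g (r * x + t * y) (s * x + u * y)"
  by (induction g) (simp, Groebner_Basis.algebra)

lemma bcf_eval_scale: "bcf_eval (map_bcf (\<lambda>e. k * e) g) x y = k * bcf_eval g x y"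
  by (cases g) (simp add: algebra_simps)

lemma bcf_subst_scale:
  "bcf_subst (map_bcf (\<lambda>e. k * e) g) r s t u = map_bcf (\<lambda>e. k * e) (bcf_subst g r s t u)"
  by (cases g) (simp add: algebra_simps)

lemma bcf_subst_scale_matrix:
  "bcf_subst g (k * r) (k * s) (k * t) (k * u) = map_bcf (\<lambda>e. k ^ 3 * e) (bcf_subst g r s t u)"
  by (cases g) (simp add: algebra_simps power2_eq_square power3_eq_cube)

lemma cubic_covariant_scale:
  "cubic_covariant (map_bcf (\<lambda>e. k * e) g) = map_bcf (\<lambda>e. k ^ 3 * e) (cubic_covariant g)"
  by (cases g) (simp add: algebra_simps power2_eq_square power3_eq_cube)

lemma bcf_disc_scale:
  fixes g :: "'a::field bcf"
  shows "bcf_disc (map_bcf (\<lambda>e. k * e) g) = k ^ 4 * bcf_disc g"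
  by (induction g) (simp, Groebner_Basis.algebra)

lemma bcf_twist_twist: "bcf_twist (bcf_twist g M) N = bcf_twist g (N ** M)"
proof -
  have "(N ** M) $ i $ j = N $ i $ 1 * M $ 1 $ j + N $ i $ 2 * M $ 2 $ j" for i j
    by (simp add: matrix_matrix_mult_def sum_2)
  then show ?thesis
    by (simp add: bcf_twist_def bcf_subst_scale bcf_subst_subst det_mul bcf.map_comp comp_def mult.assoc)
qed

lemma bcf_twist_mat_1: "bcf_twist g (mat 1) = g"
  by (cases g) (simp add: bcf_twist_def det_I, simp add: mat_def)

lemma bcf_disc_twist:
  assumes "det M \<noteq> 0"
  shows "bcf_disc (bcf_twist g M) = det M ^ 2 * bcf_disc g"
proof -
  have "bcf_disc (bcf_twist g M) = inverse (det M) ^ 4 * (det M ^ 6 * bcf_disc g)"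
    by (simp add: bcf_twist_def bcf_disc_scale bcf_disc_subst det_2)
  also have "\<dots> = det M ^ 2 * bcf_disc g"
    using assms by (simp add: field_simps flip: power_add)
  finally show ?thesis .
qed

text \<open>The cubic covariant has degree 3 in the coefficients, so the scalar factor of the twist
  enters cubed and cancels the weight \<open>det M ^ 3\<close> of the covariance.\<close>

lemma cubic_covariant_twist:
  assumes "det M \<noteq> 0"
  shows "cubic_covariant (bcf_twist g M) =
    bcf_subst (cubic_covariant g) (M $ 1 $ 1) (M $ 1 $ 2) (M $ 2 $ 1) (M $ 2 $ 2)"
proof -
  have *: "inverse (det M) ^ 3 * (det M ^ 3 * k) = k" for k
    using assms by (simp add: field_simps)
  show ?thesis
    unfolding bcf_twist_def cubic_covariant_scale cubic_covariant_subst bcf.map_comp comp_def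
      det_2[symmetric] * bcf.map_ident ..
qed

section \<open>Coordinates in the resolvent algebra and values of the Cardano covariant\<close>

text \<open>A pair \<open>(p, q)\<close> stands for the element \<open>p + q \<delta>\<close> of the resolvent algebra,
  where \<open>\<delta>\<^sup>2 = -3 \<Delta>\<close>.\<close>

definition rmult :: "'a::field \<Rightarrow> 'a \<times> 'a \<Rightarrow> 'a \<times> 'a \<Rightarrow> 'a \<times> 'a" where
  "rmult \<Delta> z w = (fst z * fst w - 3 * \<Delta> * snd z * snd w, fst z * snd w + snd z * fst w)"

definition rcube :: "'a::field \<Rightarrow> 'a \<times> 'a \<Rightarrow> 'a \<times> 'a" where
  "rcube \<Delta> z = rmult \<Delta> z (rmult \<Delta> z z)"

definition rconj :: "'a::field \<times> 'a \<Rightarrow> 'a \<times> 'a" where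
  "rconj z = (fst z, - snd z)"

definition rnorm :: "'a::field \<Rightarrow> 'a \<times> 'a \<Rightarrow> 'a" where
  "rnorm \<Delta> z = fst z ^ 2 + 3 * \<Delta> * snd z ^ 2"

lemma rcube_eq:
  "rcube \<Delta> (m, n) = (m ^ 3 - 9 * \<Delta> * m * n ^ 2, 3 * m ^ 2 * n - 3 * \<Delta> * n ^ 3)"
  by (simp add: rcube_def rmult_def algebra_simps power2_eq_square power3_eq_cube)

lemma rnorm_rmult: "rnorm \<Delta> (rmult \<Delta> z w) = rnorm \<Delta> z * rnorm \<Delta> w"
  by (simp add: rnorm_def rmult_def algebra_simps power2_eq_square)

lemma rnorm_rcube: "rnorm \<Delta> (rcube \<Delta> z) = rnorm \<Delta> z ^ 3"
  by (simp add: rcube_def rnorm_rmult power3_eq_cube)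

lemma four_nonzero:
  assumes "(2::'a::field) \<noteq> 0"
  shows "(4::'a) \<noteq> 0"
proof -
  have "(4::'a) = 2 * 2" by simp
  then show ?thesis
    using assms by (simp only: mult_eq_0_iff) simp
qed

definition cardano_pair :: "'a::field bcf \<Rightarrow> 'a \<Rightarrow> 'a \<Rightarrow> 'a \<times> 'a" where
  "cardano_pair g x y = (bcf_eval (cubic_covariant g) x y / 2, 3 * bcf_eval g x y / 2)"

text \<open>This is the syzygy divided by 4. It makes the value of the Cardano covariant a unit
  exactly where the Hessian does not vanish.\<close>

lemma rnorm_cardano_pair:
  fixes g :: "'a::field bcf"
  assumes "(2::'a) \<noteq> 0"
  shows "rnorm (bcf_disc g) (cardano_pair g x y) = hessian_form g x y ^ 3"
proof -
  have "4 * rnorm (bcf_disc g) (cardano_pair g x y) =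
      bcf_eval (cubic_covariant g) x y ^ 2 + 27 * bcf_disc g * bcf_eval g x y ^ 2"
    using assms four_nonzero[OF assms]
    by (simp add: rnorm_def cardano_pair_def field_simps power2_eq_square)
  then show ?thesis
    using cubic_syzygy[of g x y] four_nonzero[OF assms] by (metis mult_left_cancel)
qed

text \<open>Write v, v' for the two points and C* for the conjugate of C. Multiplying C(v) C*(v') =
  B^3 by C(v'), whose norm is H(v')^3, gives C(v) = (B / H(v'))^3 C(v').\<close>

lemma cardano_pair_same_cube_class:
  fixes g :: "'a::field bcf"
  assumes two: "(2::'a) \<noteq> 0" and h: "hessian_form g x' y' \<noteq> 0"
  obtains w where "cardano_pair g x y = rmult (bcf_disc g) (rcube (bcf_disc g) w) (cardano_pair g x' y')"
proof -
  obtain a b c d where g: "g = BCF a b c d" by (cases g)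
  define m n where
    "m = 2 * (b ^ 2 - 3 * a * c) * x * x' + (b * c - 9 * a * d) * (x * y' + x' * y)
      + 2 * (c ^ 2 - 3 * b * d) * y * y'"
    and "n = x' * y - x * y'"
  define D G G' e e' where "D = bcf_disc g"
    and "G = bcf_eval (cubic_covariant g) x y"
    and "G' = bcf_eval (cubic_covariant g) x' y'"
    and "e = bcf_eval g x y" and "e' = bcf_eval g x' y'"
  define H where "H = hessian_form g x' y'"
  have pol: "2 * (G * G' + 27 * D * e * e') = m ^ 3 - 9 * D * m * n ^ 2"
      "2 * (e * G' - G * e') = m ^ 2 * n - D * n ^ 3"
    using cubic_syzygy_polarised[OF g m_def n_def] by (simp_all add: D_def G_def G'_def e_def e'_def)
  have syz: "G' ^ 2 + 27 * D * e' ^ 2 = 4 * H ^ 3"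
    using cubic_syzygy[of g x' y'] by (simp add: D_def G'_def e'_def H_def)
  \<comment> \<open>With B = (m + n \<delta>) / 2, the pair \<open>(k * m, k * n)\<close> is B /
    H.\<close>
  define k where "k = inverse (2 * H)"
  have k: "2 * k * H = 1"
    using two h by (simp add: k_def H_def)
  have "rmult D (rcube D (k * m, k * n)) (G', 3 * e') = (G, 3 * e)"
    unfolding rcube_eq rmult_def using k pol syz
    by (simp, intro conjI; Groebner_Basis.algebra)
  then have "rmult D (rcube D (k * m, k * n)) (G' / 2, 3 * e' / 2) = (G / 2, 3 * e / 2)"
    by (simp add: rmult_def algebra_simps flip: add_divide_distrib diff_divide_distrib)
  then show ?thesis
    by (intro that[of "(k * m, k * n)"]) (simp add: cardano_pair_def D_def G_def G'_def e_def e'_def)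
qed

text \<open>The Hessian has discriminant -3 \<Delta>, so it is not the zero form; and a quadratic
  form that vanishes at (1, 0), (0, 1) and (1, 1) is zero over any field.\<close>

lemma hessian_form_nonzero:
  fixes g :: "'a::field bcf"
  assumes "(3::'a) \<noteq> 0" "bcf_disc g \<noteq> 0"
  obtains x y where "hessian_form g x y \<noteq> 0"
proof (rule ccontr)
  assume "\<not> thesis"
  then have "hessian_form g x y = 0" for x y
    using that by blast
  moreover obtain a b c d where g: "g = BCF a b c d" by (cases g)
  ultimately have *: "(b ^ 2 - 3 * a * c) * x ^ 2 + (b * c - 9 * a * d) * x * y
      + (c ^ 2 - 3 * b * d) * y ^ 2 = 0" for x y
    by (simp add: hessian_form_def)
  have "3 * bcf_disc g = 4 * (b ^ 2 - 3 * a * c) * (c ^ 2 - 3 * b * d) - (b * c - 9 * a * d) ^ 2"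
    unfolding g by (simp, Groebner_Basis.algebra)
  also have "\<dots> = 0"
    using *[of 1 0] *[of 0 1] *[of 1 1] by simp
  finally show False
    using assms by simp
qed

section \<open>Normal forms and the construction of twists of determinant 1\<close>

text \<open>The form with Cardano covariant \<open>z (X + k \<delta> Y)\<^sup>3\<close>.\<close>

definition cardano_normal_form :: "'a::field \<Rightarrow> 'a \<times> 'a \<Rightarrow> 'a \<Rightarrow> 'a bcf" where
  "cardano_normal_form \<Delta> z k = BCF (2 * snd z / 3) (2 * fst z * k)
     (- 6 * snd z * \<Delta> * k ^ 2) (- 2 * fst z * \<Delta> * k ^ 3)"

lemma twist_to_normal_form:
  fixes g :: "'a::field bcf"
  assumes two: "(2::'a) \<noteq> 0" and three: "(3::'a) \<noteq> 0" and h: "hessian_form g x y \<noteq> 0"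
  obtains M :: "'a ^ 2 ^ 2" where "det M = 1"
    "bcf_twist g M = cardano_normal_form (bcf_disc g) (cardano_pair g x y) (1 / (2 * hessian_form g x y))"
proof -
  obtain a b c d where g: "g = BCF a b c d" by (cases g)
  define H where "H = hessian_form g x y"
  \<comment> \<open>\<open>(t, u)\<close> is orthogonal to \<open>(x, y)\<close> with respect to the Hessian, so that the
    Hessian of the twist has no mixed term.\<close>
  define t u where "t = - ((b * c - 9 * a * d) * x + 2 * (c ^ 2 - 3 * b * d) * y)"
    and "u = 2 * (b ^ 2 - 3 * a * c) * x + (b * c - 9 * a * d) * y"
  have "(6::'a) = 2 * 3" by simp
  then have six: "(6::'a) \<noteq> 0"
    using two three by (simp only: mult_eq_0_iff) simp
  define k where "k = 1 / (2 * H)"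
  define M :: "'a ^ 2 ^ 2" where "M = vector [vector [x, y], vector [k * t, k * u]]"
  have k: "2 * H * k = 1"
    using two h by (simp add: k_def H_def)
  \<comment> \<open>Euler's relation: (t, u) is (-H_y, H_x) in terms of the partial derivatives of
    the Hessian. Scaling by \<open>k\<close> therefore makes the determinant 1.\<close>
  have "x * u - y * t = 2 * H"
    unfolding H_def t_def u_def g hessian_form_def by (simp, Groebner_Basis.algebra)
  then have det: "det M = 1"
    using k by (simp add: det_2 M_def vector_2, Groebner_Basis.algebra)
  \<comment> \<open>This and the next two identities compute the coefficients of \<lambda>,
    \<lambda>^2 and \<lambda>^3 in g(x + \<lambda> t, y + \<lambda> u). The first is the Jacobian of
    the Hessian and \<open>g\<close>, which equals the cubic covariant.\<close>
  have 1: "3 * a * x ^ 2 * t + b * (x ^ 2 * u + 2 * x * y * t)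
            + c * (2 * x * y * u + y ^ 2 * t) + 3 * d * y ^ 2 * u = bcf_eval (cubic_covariant g) x y"
    unfolding t_def u_def g by (simp, Groebner_Basis.algebra)
  have 2: "3 * a * x * t ^ 2 + b * (2 * x * t * u + y * t ^ 2)
            + c * (x * u ^ 2 + 2 * y * t * u) + 3 * d * y * u ^ 2 = - 9 * bcf_disc g * bcf_eval g x y"
    unfolding t_def u_def g by (simp, Groebner_Basis.algebra)
  have 3: "a * t ^ 3 + b * t ^ 2 * u + c * t * u ^ 2 + d * u ^ 3
       = - bcf_disc g * bcf_eval (cubic_covariant g) x y"
    unfolding t_def u_def g by (simp, Groebner_Basis.algebra)
  have "bcf_twist g M = bcf_subst g x y (k * t) (k * u)"
    by (simp add: bcf_twist_def det bcf.map_ident, simp add: M_def vector_2)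
  also have "\<dots> = BCF (bcf_eval g x y) (k * bcf_eval (cubic_covariant g) x y)
      (k ^ 2 * (- 9 * bcf_disc g * bcf_eval g x y))
      (k ^ 3 * (- bcf_disc g * bcf_eval (cubic_covariant g) x y))"
    \<comment> \<open>The order matters: the right side of \<open>3\<close> contains that of
      \<open>1\<close>.\<close>
    unfolding 3[symmetric] unfolding 2[symmetric] unfolding 1[symmetric]
    by (simp add: g del: cubic_covariant.simps bcf_disc.simps, intro conjI; Groebner_Basis.algebra)
  also have "\<dots> = cardano_normal_form (bcf_disc g) (cardano_pair g x y) k"
    using two three six by (simp add: cardano_normal_form_def cardano_pair_def)
  finally show ?thesis
    using det by (intro that) (simp_all add: k_def H_def)
qed

text \<open>The factor \<open>w\<close> moves inside the cube, where multiplication by it is a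
  linear map of determinant N(w); passing from \<open>k / rnorm \<Delta> w\<close> to
  \<open>k\<close> brings the determinant back to 1.\<close>

lemma normal_form_twist:
  fixes \<Delta> :: "'a::field"
  assumes three: "(3::'a) \<noteq> 0" and k: "k \<noteq> 0" and w: "rnorm \<Delta> w \<noteq> 0"
  obtains M :: "'a ^ 2 ^ 2" where "det M = 1"
    "bcf_twist (cardano_normal_form \<Delta> (rmult \<Delta> (rcube \<Delta> w) z) (k / rnorm \<Delta> w)) M
       = cardano_normal_form \<Delta> z k"
proof -
  obtain m n p q where wz: "w = (m, n)" "z = (p, q)" by (cases w; cases z)
  \<comment> \<open>The normal form at \<open>k = 1\<close> with second coordinate 3 c, free of
    division; \<open>k\<close> returns as a scaling of Y.\<close>
  define F where "F p c = BCF (2 * c) (2 * p) (- 18 * c * \<Delta>) (- 2 * p * \<Delta>)" for p c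
  have F: "cardano_normal_form \<Delta> (p, q) k = bcf_subst (F p (q / 3)) 1 0 0 k" for p q k
    using three by (simp add: cardano_normal_form_def F_def)
  define c where "c = q / 3"
  define p' c' where "p' = (m ^ 3 - 9 * \<Delta> * m * n ^ 2) * p - 27 * \<Delta> * (m ^ 2 * n - \<Delta> * n ^ 3) * c"
    and "c' = (m ^ 3 - 9 * \<Delta> * m * n ^ 2) * c + (m ^ 2 * n - \<Delta> * n ^ 3) * p"
  have q: "q = 3 * c" using three by (simp add: c_def)
  have pc': "rmult \<Delta> (rcube \<Delta> w) z = (p', 3 * c')"
    by (simp add: rcube_eq rmult_def wz q p'_def c'_def algebra_simps)
  define N where "N = rnorm \<Delta> w"
  have N: "N \<noteq> 0" using w by (simp add: N_def)
  \<comment> \<open>The substitution is multiplication by the conjugate of \<open>w\<close>, whose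
    cube times w^3 is N^3.\<close>
  have key: "bcf_subst (F p' c') m (- n) (3 * \<Delta> * n) m = map_bcf (\<lambda>e. N ^ 3 * e) (F p c)"
    by (simp add: F_def p'_def c'_def N_def rnorm_def wz, intro conjI; Groebner_Basis.algebra)
  \<comment> \<open>\<open>M\<close> solves \<open>w (X' + k \<delta> Y' / N) = X + k \<delta> Y\<close> for \<open>X'\<close> and \<open>Y'\<close>.\<close>
  define M :: "'a ^ 2 ^ 2" where
    "M = vector [vector [m / N, - n / k], vector [3 * \<Delta> * n * k / N, m]]"
  have "m * m + 3 * \<Delta> * n * n = N"
    by (simp add: N_def rnorm_def wz power2_eq_square)
  then have det: "det M = 1"
    using N k by (simp add: det_2 M_def vector_2 field_simps)
  have "bcf_twist (cardano_normal_form \<Delta> (rmult \<Delta> (rcube \<Delta> w) z) (k / N)) M =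
      bcf_subst (bcf_subst (F p' c') 1 0 0 (k / N)) (m / N) (- n / k) (3 * \<Delta> * n * k / N) m"
    using three by (simp add: bcf_twist_def det bcf.map_ident pc' F, simp add: M_def vector_2)
  also have "\<dots> = bcf_subst (F p' c') (inverse N * m) (inverse N * (- n))
      (inverse N * (3 * \<Delta> * n * k)) (inverse N * (m * k))"
    using k by (simp add: bcf_subst_subst field_simps)
  also have "\<dots> = map_bcf (\<lambda>e. inverse N ^ 3 * e)
      (bcf_subst (bcf_subst (F p' c') m (- n) (3 * \<Delta> * n) m) 1 0 0 k)"
    by (simp only: bcf_subst_scale_matrix bcf_subst_subst) (simp add: ac_simps)
  also have "\<dots> = cardano_normal_form \<Delta> z k"
    using N by (simp add: key bcf_subst_scale bcf.map_comp comp_def bcf.map_ident wz F c_def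
        flip: mult.assoc power_mult_distrib)
  finally show ?thesis
    using det by (intro that) (simp_all add: N_def)
qed

text \<open>A cube root of unity \<open>\<rho>\<close> can be absorbed into \<open>w\<close>, since \<open>\<rho>\<^sup>2\<close> has norm \<open>\<rho>\<^sup>4 = \<rho>\<close>;
  this turns the equality of the cubed norms into one of the norms themselves.\<close>

lemma cube_root_adjust_norm:
  fixes \<Delta> :: "'a::field"
  assumes "h ^ 3 = rnorm \<Delta> w ^ 3" "h \<noteq> 0"
  obtains v where "rnorm \<Delta> v = h" "rcube \<Delta> v = rcube \<Delta> w"
proof -
  define N where "N = rnorm \<Delta> w"
  have N: "N \<noteq> 0" using assms by (auto simp: N_def)
  define \<rho> where "\<rho> = h / N"
  have \<rho>: "\<rho> ^ 3 = 1" using assms N by (simp add: \<rho>_def power_divide N_def)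
  define v where "v = (\<rho> ^ 2 * fst w, \<rho> ^ 2 * snd w)"
  have "rnorm \<Delta> v = \<rho> ^ 3 * \<rho> * N"
    by (simp add: rnorm_def v_def N_def algebra_simps power2_eq_square power3_eq_cube)
  then have "rnorm \<Delta> v = h"
    using N by (simp add: \<rho>, simp add: \<rho>_def)
  moreover have "rcube \<Delta> v = (let r = (\<rho> ^ 3) ^ 2 in (r * fst (rcube \<Delta> w), r * snd (rcube \<Delta> w)))"
    by (simp add: rcube_def rmult_def v_def Let_def algebra_simps power2_eq_square power3_eq_cube)
  then have "rcube \<Delta> v = rcube \<Delta> w"
    by (simp add: \<rho>)
  ultimately show ?thesis
    using that by blast
qed

text \<open>Each form is twisted to its normal form, and \<open>normal_form_twist\<close> links the
  two once the multiplier has norm \<open>h1 / h2\<close>. Norms of \<open>eq\<close> give this only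
  after cubing, hence the adjusted multiplier \<open>v\<close>.\<close>

lemma cardano_cube_class_imp_twist:
  fixes g1 g2 :: "'a::field bcf"
  assumes two: "(2::'a) \<noteq> 0" and three: "(3::'a) \<noteq> 0"
    and disc: "bcf_disc g1 = \<Delta>" "bcf_disc g2 = \<Delta>"
    and h: "hessian_form g1 x1 y1 \<noteq> 0" "hessian_form g2 x2 y2 \<noteq> 0"
    and eq: "cardano_pair g1 x1 y1 = rmult \<Delta> (rcube \<Delta> w) (cardano_pair g2 x2 y2)"
  obtains M where "det M = 1" "g2 = bcf_twist g1 M"
proof -
  define h1 h2 where "h1 = hessian_form g1 x1 y1" and "h2 = hessian_form g2 x2 y2"
  have nz: "h1 \<noteq> 0" "h2 \<noteq> 0" using h by (simp_all add: h1_def h2_def)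
  have "h1 ^ 3 = rnorm \<Delta> w ^ 3 * h2 ^ 3"
    using rnorm_cardano_pair[OF two, of g1 x1 y1] rnorm_cardano_pair[OF two, of g2 x2 y2]
    by (simp add: disc eq rnorm_rmult rnorm_rcube h1_def h2_def)
  then have "(h1 / h2) ^ 3 = rnorm \<Delta> w ^ 3"
    using nz by (simp add: field_simps)
  then obtain v where v: "rnorm \<Delta> v = h1 / h2" "rcube \<Delta> v = rcube \<Delta> w"
    using cube_root_adjust_norm nz by (metis divide_eq_0_iff)
  obtain M1 where M1: "det M1 = 1"
      "bcf_twist g1 M1 = cardano_normal_form \<Delta> (cardano_pair g1 x1 y1) (1 / (2 * h1))"
    using twist_to_normal_form[OF two three h(1)] disc by (metis h1_def)
  obtain M2 where M2: "det M2 = 1"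
      "bcf_twist g2 M2 = cardano_normal_form \<Delta> (cardano_pair g2 x2 y2) (1 / (2 * h2))"
    using twist_to_normal_form[OF two three h(2)] disc by (metis h2_def)
  have k: "1 / (2 * h2) \<noteq> 0" and rv: "rnorm \<Delta> v \<noteq> 0"
    using nz two by (simp_all add: v)
  obtain M3 where M3: "det M3 = 1"
      "bcf_twist (cardano_normal_form \<Delta> (rmult \<Delta> (rcube \<Delta> v) (cardano_pair g2 x2 y2))
         (1 / (2 * h2) / rnorm \<Delta> v)) M3 = cardano_normal_form \<Delta> (cardano_pair g2 x2 y2) (1 / (2 * h2))"
    by (rule normal_form_twist[OF three k rv])
  \<comment> \<open>The adjusted norm makes the parameters of the two normal forms of
    \<open>g1\<close> agree.\<close>
  moreover have "1 / (2 * h2) / rnorm \<Delta> v = 1 / (2 * h1)"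
    using nz by (simp add: v)
  ultimately have M3': "bcf_twist g2 M2 = bcf_twist (bcf_twist g1 M1) M3"
    by (simp only: M1(2) M2(2) eq v(2))
  obtain M4 where M4: "M4 ** M2 = mat 1"
    using M2(1) by (metis invertible_det_nz invertible_left_inverse zero_neq_one)
  have "g2 = bcf_twist (bcf_twist g2 M2) M4"
    by (simp add: bcf_twist_twist M4 bcf_twist_mat_1)
  also have "\<dots> = bcf_twist g1 (M4 ** (M3 ** M1))"
    by (simp add: bcf_twist_twist M3')
  finally have "g2 = bcf_twist g1 (M4 ** (M3 ** M1))" .
  moreover have "det M4 = 1"
    using M4 M2(1) by (metis det_I det_mul mult.right_neutral)
  ultimately show ?thesis
    using M1(1) M3(1) by (intro that[of "M4 ** (M3 ** M1)"]) (simp_all add: det_mul)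
qed

text \<open>Only the \<delta>-coordinate picks up a factor, so determinant -1 amounts to
  conjugation.\<close>

lemma cardano_pair_twist:
  assumes "det M \<noteq> 0"
  shows "cardano_pair (bcf_twist g M) x y =
    (let z = cardano_pair g (M $ 1 $ 1 * x + M $ 2 $ 1 * y) (M $ 1 $ 2 * x + M $ 2 $ 2 * y)
     in (fst z, inverse (det M) * snd z))"
  using assms by (simp add: cardano_pair_def cubic_covariant_twist bcf_eval_subst Let_def)
    (simp add: bcf_twist_def bcf_eval_scale bcf_eval_subst)

section \<open>The resolvent algebra and its units modulo cubes, in coordinates\<close>

definition resolvent_elt :: "'a::field \<Rightarrow> 'a \<times> 'a \<Rightarrow> 'a poly set" where
  "resolvent_elt \<Delta> z = resolvent_class \<Delta> [:fst z, snd z:]"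

lemma ideal_resolvent_ideal:
  "ideal (resolvent_ideal \<Delta>) (ring_of_type_algebra :: 'a::field poly ring)"
  by (rule cring.cgenideal_ideal[OF cring_from_type_algebra]) (simp add: ring_of_type_algebra_def)

lemma cring_resolvent_algebra: "cring (resolvent_algebra \<Delta>)"
  unfolding resolvent_algebra_def
  by (rule ideal.quotient_is_cring[OF ideal_resolvent_ideal cring_from_type_algebra])

lemma resolvent_class_hom:
  "resolvent_class \<Delta> \<in> ring_hom ring_of_type_algebra (resolvent_algebra \<Delta>)"
proof -
  have "(\<lambda>p. resolvent_class \<Delta> p) \<in> ring_hom ring_of_type_algebra (resolvent_algebra \<Delta>)"
    unfolding resolvent_class_def resolvent_algebra_def
    by (rule ideal.rcos_ring_hom[OF ideal_resolvent_ideal])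
  then show ?thesis by simp
qed

lemma
  shows resolvent_class_mult:
      "resolvent_class \<Delta> p \<otimes>\<^bsub>resolvent_algebra \<Delta>\<^esub> resolvent_class \<Delta> q = resolvent_class \<Delta> (p * q)"
    and resolvent_class_add:
      "resolvent_class \<Delta> p \<oplus>\<^bsub>resolvent_algebra \<Delta>\<^esub> resolvent_class \<Delta> q = resolvent_class \<Delta> (p + q)"
    and resolvent_class_one: "\<one>\<^bsub>resolvent_algebra \<Delta>\<^esub> = resolvent_class \<Delta> 1"
  using ring_hom_mult[OF resolvent_class_hom, of p q \<Delta>] ring_hom_add[OF resolvent_class_hom, of p q \<Delta>]
    ring_hom_one[OF resolvent_class_hom, of \<Delta>]
  by (simp_all add: ring_of_type_algebra_def)

lemma carrier_resolvent_algebra: "carrier (resolvent_algebra \<Delta>) = range (resolvent_class \<Delta>)"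
  by (auto simp: resolvent_algebra_def resolvent_class_def[abs_def] FactRing_def A_RCOSETS_def'
      ring_of_type_algebra_def)

lemma a_minus_ring_of_type_algebra:
  "p \<ominus>\<^bsub>ring_of_type_algebra\<^esub> q = p - (q :: 'a::comm_ring_1)"
proof -
  interpret R: cring "ring_of_type_algebra :: 'a ring" by (rule cring_from_type_algebra)
  have "\<ominus>\<^bsub>ring_of_type_algebra\<^esub> q = - q"
    by (rule R.minus_equality) (auto simp: ring_of_type_algebra_def)
  then show ?thesis
    by (simp add: a_minus_def ring_of_type_algebra_def)
qed

lemma resolvent_class_eq_iff:
  "resolvent_class \<Delta> p = resolvent_class \<Delta> q \<longleftrightarrow> [:3 * \<Delta>, 0, 1:] dvd p - q"
proof -
  interpret R: cring "ring_of_type_algebra :: 'a poly ring" by (rule cring_from_type_algebra)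
  have "resolvent_class \<Delta> p = resolvent_class \<Delta> q \<longleftrightarrow> p - q \<in> resolvent_ideal \<Delta>"
    using R.quotient_eq_iff_same_a_r_cos[OF ideal_resolvent_ideal, of p q]
    by (simp add: resolvent_class_def a_minus_ring_of_type_algebra) (simp add: ring_of_type_algebra_def)
  also have "\<dots> \<longleftrightarrow> [:3 * \<Delta>, 0, 1:] dvd p - q"
    by (auto simp: cgenideal_def ring_of_type_algebra_def dvd_def mult.commute)
  finally show ?thesis .
qed

text \<open>A polynomial of degree 2 divides one of degree at most 1 only if the latter is zero.
  Together with \<open>resolvent_class_eq_elt\<close> this makes 1, \<delta> a basis over K.\<close>

lemma resolvent_elt_eq_iff: "resolvent_elt \<Delta> z = resolvent_elt \<Delta> w \<longleftrightarrow> z = w"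
proof
  assume "resolvent_elt \<Delta> z = resolvent_elt \<Delta> w"
  then have "[:3 * \<Delta>, 0, 1:] dvd [:fst z - fst w, snd z - snd w:]"
    by (simp add: resolvent_elt_def resolvent_class_eq_iff)
  moreover have "Polynomial.degree [:fst z - fst w, snd z - snd w:] \<le> 1"
    by simp
  ultimately have "[:fst z - fst w, snd z - snd w:] = 0"
    using dvd_imp_degree_le[of "[:3 * \<Delta>, 0, 1:]" "[:fst z - fst w, snd z - snd w:]"]
    by fastforce
  then show "z = w"
    by (simp add: prod_eq_iff split: if_splits)
qed simp

lemma resolvent_class_eq_elt:
  obtains z where "resolvent_class \<Delta> p = resolvent_elt \<Delta> z"
proof -
  define r where "r = p mod [:3 * \<Delta>, 0, 1:]"
  have "Polynomial.degree r < 2"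
    using degree_mod_less'[of "[:3 * \<Delta>, 0, 1:]" p] by (cases "r = 0") (auto simp: r_def)
  then have "r = [:poly.coeff r 0, poly.coeff r 1:]"
    by (intro poly_eqI) (auto simp: coeff_pCons coeff_eq_0 split: nat.splits)
  moreover have "resolvent_class \<Delta> p = resolvent_class \<Delta> r"
    by (simp add: resolvent_class_eq_iff r_def dvd_minus_mod)
  ultimately show ?thesis
    using that[of "(poly.coeff r 0, poly.coeff r 1)"] by (simp add: resolvent_elt_def)
qed

lemma resolvent_elt_mult:
  "resolvent_elt \<Delta> z \<otimes>\<^bsub>resolvent_algebra \<Delta>\<^esub> resolvent_elt \<Delta> w = resolvent_elt \<Delta> (rmult \<Delta> z w)"
  unfolding resolvent_elt_def resolvent_class_mult resolvent_class_eq_iff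
  \<comment> \<open>The quotient is the coefficient of T^2 in the product.\<close>
  by (rule dvdI[of _ _ "[:snd z * snd w:]"]) (simp add: rmult_def algebra_simps)

lemma resolvent_elt_one: "\<one>\<^bsub>resolvent_algebra \<Delta>\<^esub> = resolvent_elt \<Delta> (1, 0)"
  by (simp add: resolvent_class_one resolvent_elt_def one_pCons)

lemma carrier_resolvent_algebra_elt:
  "carrier (resolvent_algebra \<Delta>) = range (resolvent_elt \<Delta>)"
proof -
  have "resolvent_class \<Delta> p \<in> range (resolvent_elt \<Delta>)" for p
    using resolvent_class_eq_elt[of \<Delta> p] by (metis rangeI)
  then show ?thesis
    by (auto simp: carrier_resolvent_algebra resolvent_elt_def)
qed

lemma rmult_rconj: "rmult \<Delta> z (rconj z) = (rnorm \<Delta> z, 0)"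
  by (simp add: rmult_def rconj_def rnorm_def power2_eq_square algebra_simps)

text \<open>The norm is multiplicative, and the conjugate divided by the norm is the inverse; this
  covers the case where L is not a field.\<close>

lemma resolvent_elt_unit_iff:
  "resolvent_elt \<Delta> z \<in> carrier (resolvent_units \<Delta>) \<longleftrightarrow> rnorm \<Delta> z \<noteq> 0"
proof -
  have comm: "rmult \<Delta> w z = rmult \<Delta> z w" for w
    by (simp add: rmult_def algebra_simps)
  have "resolvent_elt \<Delta> z \<in> Units (resolvent_algebra \<Delta>) \<longleftrightarrow> (\<exists>w. rmult \<Delta> z w = (1, 0))"
    unfolding Units_def carrier_resolvent_algebra_elt
    by (simp add: bex_simps resolvent_elt_mult resolvent_elt_one resolvent_elt_eq_iff comm)
  also have "\<dots> \<longleftrightarrow> rnorm \<Delta> z \<noteq> 0"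
  proof
    assume "\<exists>w. rmult \<Delta> z w = (1, 0)"
    then obtain w where "rmult \<Delta> z w = (1, 0)" ..
    then have "rnorm \<Delta> z * rnorm \<Delta> w = 1"
      by (simp flip: rnorm_rmult) (simp add: rnorm_def)
    then show "rnorm \<Delta> z \<noteq> 0" by auto
  next
    assume N: "rnorm \<Delta> z \<noteq> 0"
    have "rmult \<Delta> z (fst (rconj z) / rnorm \<Delta> z, snd (rconj z) / rnorm \<Delta> z) = (1, 0)"
      using rmult_rconj[of \<Delta> z] N
      by (simp add: rmult_def flip: diff_divide_distrib add_divide_distrib)
    then show "\<exists>w. rmult \<Delta> z w = (1, 0)" ..
  qed
  finally show ?thesis
    by (simp add: resolvent_units_def units_of_carrier)
qed

lemma carrier_resolvent_units:
  "carrier (resolvent_units \<Delta>) = resolvent_elt \<Delta> ` {z. rnorm \<Delta> z \<noteq> 0}"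
proof -
  interpret L: cring "resolvent_algebra \<Delta>" by (rule cring_resolvent_algebra)
  have "carrier (resolvent_units \<Delta>) \<subseteq> range (resolvent_elt \<Delta>)"
    by (auto simp: resolvent_units_def units_of_carrier simp flip: carrier_resolvent_algebra_elt)
  then show ?thesis
    using resolvent_elt_unit_iff by fast
qed

lemma resolvent_units_mult:
  "resolvent_elt \<Delta> z \<otimes>\<^bsub>resolvent_units \<Delta>\<^esub> resolvent_elt \<Delta> w = resolvent_elt \<Delta> (rmult \<Delta> z w)"
  by (simp add: resolvent_units_def units_of_mult resolvent_elt_mult)

lemma comm_group_resolvent_units: "comm_group (resolvent_units \<Delta>)"
  unfolding resolvent_units_def
  using cring_resolvent_algebra by (rule comm_monoid.units_comm_group[OF cring.axioms(2)])

lemma resolvent_elt_cube: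
  "resolvent_elt \<Delta> w [^]\<^bsub>resolvent_units \<Delta>\<^esub> (3::nat) = resolvent_elt \<Delta> (rcube \<Delta> w)"
proof -
  have "\<one>\<^bsub>resolvent_units \<Delta>\<^esub> = resolvent_elt \<Delta> (1, 0)"
    by (simp add: resolvent_units_def units_of_one resolvent_elt_one)
  then show ?thesis
    by (simp add: numeral_3_eq_3 nat_pow_def resolvent_units_mult)
      (simp add: rcube_def rmult_def algebra_simps)
qed

lemma resolvent_cubes_eq: "resolvent_cubes \<Delta> = resolvent_elt \<Delta> ` rcube \<Delta> ` {w. rnorm \<Delta> w \<noteq> 0}"
  unfolding resolvent_cubes_def carrier_resolvent_units image_image resolvent_elt_cube ..

lemma subgroup_resolvent_cubes: "subgroup (resolvent_cubes \<Delta>) (resolvent_units \<Delta>)"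
proof -
  interpret U: comm_group "resolvent_units \<Delta>" by (rule comm_group_resolvent_units)
  have "(\<lambda>w. w [^]\<^bsub>resolvent_units \<Delta>\<^esub> (3::nat)) \<in> hom (resolvent_units \<Delta>) (resolvent_units \<Delta>)"
    by (auto simp: hom_def U.nat_pow_distrib)
  then show ?thesis
    unfolding resolvent_cubes_def
    by (intro group_hom.img_is_subgroup group_hom.intro U.is_group group_hom_axioms.intro)
qed

abbreviation cube_class :: "'a::field \<Rightarrow> 'a \<times> 'a \<Rightarrow> 'a poly set set" where
  "cube_class \<Delta> z \<equiv> resolvent_cubes \<Delta> #>\<^bsub>resolvent_units \<Delta>\<^esub> resolvent_elt \<Delta> z"

lemma cube_class_eq_iff:
  assumes "rnorm \<Delta> z \<noteq> 0" "rnorm \<Delta> z' \<noteq> 0"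
  shows "cube_class \<Delta> z = cube_class \<Delta> z' \<longleftrightarrow> (\<exists>w. z = rmult \<Delta> (rcube \<Delta> w) z')"
proof -
  interpret U: comm_group "resolvent_units \<Delta>" by (rule comm_group_resolvent_units)
  have units: "resolvent_elt \<Delta> z \<in> carrier (resolvent_units \<Delta>)"
      "resolvent_elt \<Delta> z' \<in> carrier (resolvent_units \<Delta>)"
    using assms by (simp_all add: resolvent_elt_unit_iff)
  have "cube_class \<Delta> z = cube_class \<Delta> z' \<longleftrightarrow> resolvent_elt \<Delta> z \<in> cube_class \<Delta> z'"
    using U.repr_independence[OF _ units(2) subgroup_resolvent_cubes]
      U.repr_independenceD[OF subgroup_resolvent_cubes units(1)] by metis
  also have "\<dots> \<longleftrightarrow> (\<exists>w. rnorm \<Delta> w \<noteq> 0 \<and> z = rmult \<Delta> (rcube \<Delta> w) z')"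
    by (simp add: r_coset_def resolvent_cubes_eq resolvent_units_mult resolvent_elt_eq_iff)
  \<comment> \<open>Any such \<open>w\<close> is a unit, since N(w)^3 N(z') = N(z) is
    nonzero.\<close>
  also have "\<dots> \<longleftrightarrow> (\<exists>w. z = rmult \<Delta> (rcube \<Delta> w) z')"
    using assms(1) by (metis mult_zero_left rnorm_rmult rnorm_rcube power_zero_numeral)
  finally show ?thesis .
qed

lemma comm_group_units_mod_cubes: "comm_group (units_mod_cubes \<Delta>)"
  unfolding units_mod_cubes_def
  by (rule comm_group.abelian_FactGroup[OF comm_group_resolvent_units subgroup_resolvent_cubes])

lemma carrier_units_mod_cubes:
  "carrier (units_mod_cubes \<Delta>) = cube_class \<Delta> ` {z. rnorm \<Delta> z \<noteq> 0}"
  by (auto simp: units_mod_cubes_def carrier_FactGroup carrier_resolvent_units)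

lemma cube_class_mult:
  assumes "rnorm \<Delta> z \<noteq> 0" "rnorm \<Delta> z' \<noteq> 0"
  shows "cube_class \<Delta> z \<otimes>\<^bsub>units_mod_cubes \<Delta>\<^esub> cube_class \<Delta> z' = cube_class \<Delta> (rmult \<Delta> z z')"
  using normal.rcos_sum[OF comm_group.subgroup_imp_normal[OF comm_group_resolvent_units
        subgroup_resolvent_cubes], of "resolvent_elt \<Delta> z" \<Delta> "resolvent_elt \<Delta> z'"] assms
  by (simp add: units_mod_cubes_def resolvent_elt_unit_iff resolvent_units_mult)

lemma cube_class_rcube:
  assumes "rnorm \<Delta> w \<noteq> 0"
  shows "cube_class \<Delta> (rcube \<Delta> w) = \<one>\<^bsub>units_mod_cubes \<Delta>\<^esub>"
  using group.coset_join2[OF comm_group.axioms(2)[OF comm_group_resolvent_units] _ subgroup_resolvent_cubes,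
      of "resolvent_elt \<Delta> (rcube \<Delta> w)" \<Delta>] assms
  by (simp add: units_mod_cubes_def resolvent_elt_unit_iff rnorm_rcube resolvent_cubes_eq)

lemma inv_cube_class:
  assumes "rnorm \<Delta> z = h ^ 3" "h \<noteq> 0"
  shows "inv\<^bsub>units_mod_cubes \<Delta>\<^esub> cube_class \<Delta> z = cube_class \<Delta> (rconj z)"
proof -
  interpret Q: comm_group "units_mod_cubes \<Delta>" by (rule comm_group_units_mod_cubes)
  have conj: "rnorm \<Delta> (rconj z) = h ^ 3"
    using assms by (simp add: rnorm_def rconj_def)
  have "rmult \<Delta> z (rconj z) = rcube \<Delta> (h, 0)"
    by (simp add: rmult_rconj assms rcube_eq)
  then have "cube_class \<Delta> z \<otimes>\<^bsub>units_mod_cubes \<Delta>\<^esub> cube_class \<Delta> (rconj z) = \<one>\<^bsub>units_mod_cubes \<Delta>\<^esub>"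
    using assms conj by (simp add: cube_class_mult cube_class_rcube rnorm_def)
  then show ?thesis
    using assms conj by (intro Q.inv_equality) (auto simp: carrier_units_mod_cubes Q.m_comm)
qed

section \<open>The Cardano invariant and its behaviour under twists\<close>

lemma cardano_covariant_eq: "cardano_covariant \<Delta> g x y = resolvent_elt \<Delta> (cardano_pair g x y)"
  by (simp add: cardano_covariant_def Let_def resolvent_const_def resolvent_delta_def
      resolvent_class_mult resolvent_class_add resolvent_elt_def cardano_pair_def algebra_simps)

text \<open>Evaluates the definite description: the admissible points are those with nonzero
  Hessian, and by \<open>cardano_pair_same_cube_class\<close> they all give one class.\<close>

lemma cardano_invariant_eq:
  fixes g :: "'a::field bcf"
  assumes two: "(2::'a) \<noteq> 0" and disc: "bcf_disc g = \<Delta>" and h: "hessian_form g x y \<noteq> 0"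
  shows "cardano_invariant \<Delta> g = cube_class \<Delta> (cardano_pair g x y)"
proof -
  have unit: "cardano_covariant \<Delta> g u v \<in> carrier (resolvent_units \<Delta>) \<longleftrightarrow> hessian_form g u v \<noteq> 0" for u v
    using rnorm_cardano_pair[OF two, of g u v] disc
    by (simp add: cardano_covariant_eq resolvent_elt_unit_iff)
  have same: "cube_class \<Delta> (cardano_pair g u v) = cube_class \<Delta> (cardano_pair g x y)"
    if "hessian_form g u v \<noteq> 0" for u v
  proof -
    obtain w where "cardano_pair g u v = rmult \<Delta> (rcube \<Delta> w) (cardano_pair g x y)"
      using cardano_pair_same_cube_class[OF two h] disc by blast
    moreover have "rnorm \<Delta> (cardano_pair g u v) \<noteq> 0" "rnorm \<Delta> (cardano_pair g x y) \<noteq> 0"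
      using rnorm_cardano_pair[OF two, of g] disc h that by auto
    ultimately show ?thesis
      using cube_class_eq_iff by blast
  qed
  show ?thesis
    unfolding cardano_invariant_def unit unfolding cardano_covariant_eq
  proof (rule the_equality)
    show "\<exists>u v. hessian_form g u v \<noteq> 0 \<and>
        cube_class \<Delta> (cardano_pair g x y) = cube_class \<Delta> (cardano_pair g u v)"
      using h by blast
  next
    fix \<zeta> assume "\<exists>u v. hessian_form g u v \<noteq> 0 \<and> \<zeta> = cube_class \<Delta> (cardano_pair g u v)"
    then obtain u v where "hessian_form g u v \<noteq> 0" "\<zeta> = cube_class \<Delta> (cardano_pair g u v)"
      by blast
    then show "\<zeta> = cube_class \<Delta> (cardano_pair g x y)"
      using same[of u v] by metis
  qed
qed

lemma cardano_invariant_in_carrier: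
  fixes g :: "'a::field bcf"
  assumes "(2::'a) \<noteq> 0" "(3::'a) \<noteq> 0" "bcf_disc g = \<Delta>" "\<Delta> \<noteq> 0"
  shows "cardano_invariant \<Delta> g \<in> carrier (units_mod_cubes \<Delta>)"
proof -
  obtain x y where "hessian_form g x y \<noteq> 0"
    using hessian_form_nonzero assms by metis
  then show ?thesis
    using cardano_invariant_eq[of g \<Delta> x y] rnorm_cardano_pair[of g x y] assms
    by (auto simp: carrier_units_mod_cubes)
qed

lemma cardano_invariant_twist:
  fixes g :: "'a::field bcf" and M :: "'a ^ 2 ^ 2"
  assumes two: "(2::'a) \<noteq> 0" and three: "(3::'a) \<noteq> 0" and disc: "bcf_disc g = \<Delta>" "\<Delta> \<noteq> 0"
  shows "det M = 1 \<Longrightarrow> cardano_invariant \<Delta> (bcf_twist g M) = cardano_invariant \<Delta> g"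
    and "det M = -1 \<Longrightarrow>
      cardano_invariant \<Delta> (bcf_twist g M) = inv\<^bsub>units_mod_cubes \<Delta>\<^esub> cardano_invariant \<Delta> g"
proof -
  have *: "cardano_invariant \<Delta> (bcf_twist g M) = (if det M = 1 then cardano_invariant \<Delta> g
      else inv\<^bsub>units_mod_cubes \<Delta>\<^esub> cardano_invariant \<Delta> g)" if det: "det M = 1 \<or> det M = -1"
  proof -
    have disc': "bcf_disc (bcf_twist g M) = \<Delta>"
      using bcf_disc_twist[of M g] det disc by auto
    obtain x y where h: "hessian_form (bcf_twist g M) x y \<noteq> 0"
      using hessian_form_nonzero[OF three] disc disc' by metis
    \<comment> \<open>The row vector (x, y) times \<open>M\<close>: the twist at (x, y) is governed
      by \<open>g\<close> at this point.\<close>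
    define x' y' where "x' = M $ 1 $ 1 * x + M $ 2 $ 1 * y" and "y' = M $ 1 $ 2 * x + M $ 2 $ 2 * y"
    have pair: "cardano_pair (bcf_twist g M) x y =
        (if det M = 1 then cardano_pair g x' y' else rconj (cardano_pair g x' y'))"
      using det by (auto simp: cardano_pair_twist x'_def y'_def Let_def rconj_def)
    then have "rnorm \<Delta> (cardano_pair (bcf_twist g M) x y) = rnorm \<Delta> (cardano_pair g x' y')"
      by (simp add: rconj_def rnorm_def)
    then have h': "hessian_form g x' y' \<noteq> 0"
      using h rnorm_cardano_pair[OF two, of "bcf_twist g M" x y] rnorm_cardano_pair[OF two, of g x' y']
        disc disc' by auto
    show ?thesis
      using pair inv_cube_class[of \<Delta> "cardano_pair g x' y'", OF _ h']
        rnorm_cardano_pair[OF two, of g x' y'] disc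
      by (simp add: cardano_invariant_eq[OF two disc' h] cardano_invariant_eq[OF two disc(1) h'])
  qed
  show "det M = 1 \<Longrightarrow> cardano_invariant \<Delta> (bcf_twist g M) = cardano_invariant \<Delta> g"
    using * by simp
  show "cardano_invariant \<Delta> (bcf_twist g M) = inv\<^bsub>units_mod_cubes \<Delta>\<^esub> cardano_invariant \<Delta> g"
    if "det M = -1"
  proof -
    have "(-1::'a) \<noteq> 1"
      using two by (metis add.right_inverse one_add_one)
    with that show ?thesis
      using * by auto
  qed
qed

lemma cardano_invariant_eq_imp_twist:
  fixes g1 g2 :: "'a::field bcf"
  assumes two: "(2::'a) \<noteq> 0" and three: "(3::'a) \<noteq> 0"
    and disc: "bcf_disc g1 = \<Delta>" "bcf_disc g2 = \<Delta>" "\<Delta> \<noteq> 0"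
    and eq: "cardano_invariant \<Delta> g1 = cardano_invariant \<Delta> g2"
  obtains M where "det M = 1" "g2 = bcf_twist g1 M"
proof -
  obtain x1 y1 where h1: "hessian_form g1 x1 y1 \<noteq> 0"
    using hessian_form_nonzero[OF three] disc by metis
  obtain x2 y2 where h2: "hessian_form g2 x2 y2 \<noteq> 0"
    using hessian_form_nonzero[OF three] disc by metis
  have "rnorm \<Delta> (cardano_pair g1 x1 y1) \<noteq> 0" "rnorm \<Delta> (cardano_pair g2 x2 y2) \<noteq> 0"
    using rnorm_cardano_pair[OF two] disc h1 h2 by (metis power_not_zero)+
  then obtain w where "cardano_pair g1 x1 y1 = rmult \<Delta> (rcube \<Delta> w) (cardano_pair g2 x2 y2)"
    using eq cube_class_eq_iff[of \<Delta> "cardano_pair g1 x1 y1" "cardano_pair g2 x2 y2"]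
      cardano_invariant_eq[OF two disc(1) h1] cardano_invariant_eq[OF two disc(2) h2] by metis
  then show ?thesis
    using cardano_cube_class_imp_twist[OF two three disc(1,2) h1 h2] that by blast
qed

section \<open>Generated subgroups and the classification\<close>

lemma units_mod_cubes_cube:
  assumes "q \<in> carrier (units_mod_cubes \<Delta>)"
  shows "q \<otimes>\<^bsub>units_mod_cubes \<Delta>\<^esub> (q \<otimes>\<^bsub>units_mod_cubes \<Delta>\<^esub> q) = \<one>\<^bsub>units_mod_cubes \<Delta>\<^esub>"
proof -
  obtain z where "rnorm \<Delta> z \<noteq> 0" "q = cube_class \<Delta> z"
    using assms by (auto simp: carrier_units_mod_cubes)
  then show ?thesis
    by (simp add: cube_class_mult rnorm_rmult cube_class_rcube flip: rcube_def)
qed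

text \<open>The subgroup generated by \<open>y\<close> is {1, y, inv y}, so only the case of trivial
  \<open>x\<close> needs separate care.\<close>

lemma (in group) generate_singleton_eq_iff_exponent_3:
  assumes x: "x \<in> carrier G" and y: "y \<in> carrier G"
    and cube: "y \<otimes> (y \<otimes> y) = \<one>"
  shows "generate G {x} = generate G {y} \<longleftrightarrow> x = y \<or> x = inv y"
proof
  assume eq: "generate G {x} = generate G {y}"
  have "y \<otimes> y = inv y"
    using cube y by (metis inv_equality m_closed inv_inv)
  moreover have "inv y \<otimes> inv y = y"
    using \<open>y \<otimes> y = inv y\<close> y by (metis inv_inv inv_mult_group)
  ultimately have prods: "a \<otimes> b \<in> {\<one>, y, inv y}"
    if "a \<in> {\<one>, y, inv y}" "b \<in> {\<one>, y, inv y}" for a b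
    using that y by auto
  have "h \<in> {\<one>, y, inv y}" if "h \<in> generate G {y}" for h
    using that by (induction rule: generate.induct) (use prods in auto)
  moreover have "x \<in> generate G {y}"
    using generate.incl[of x "{x}" G] eq by simp
  \<comment> \<open>A trivial \<open>x\<close> generates the trivial subgroup, which then contains
    \<open>y\<close>.\<close>
  moreover have "y = \<one>" if "x = \<one>"
    using generate.incl[of y "{y}" G] eq generate_one that by auto
  ultimately show "x = y \<or> x = inv y"
    by auto
next
  assume "x = y \<or> x = inv y"
  then show "generate G {x} = generate G {y}"
  proof
    assume xy: "x = inv y"
    have "x \<in> generate G {y}" "y \<in> generate G {x}"
      using generate.inv[of y "{y}" G] generate.inv[of x "{x}" G] xy y by auto
    then show ?thesis
      using x y by (intro equalityI generate_subgroup_incl generate_is_subgroup) auto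
  qed simp
qed

theorem theorem4p2:
  fixes \<Delta> :: "'a::field" and g1 g2 :: "'a bcf"
  assumes "CHAR('a) \<noteq> 2" and "CHAR('a) \<noteq> 3"
    and "\<Delta> \<noteq> 0"
    and "bcf_disc g1 = \<Delta>" and "bcf_disc g2 = \<Delta>"
  shows "((\<exists>M :: 'a ^ 2 ^ 2. invertible M \<and> det M = 1 \<and> g2 = bcf_twist g1 M) \<longleftrightarrow>
            cardano_invariant \<Delta> g1 = cardano_invariant \<Delta> g2) \<and>
         ((\<exists>M :: 'a ^ 2 ^ 2. invertible M \<and> det M = - 1 \<and> g2 = bcf_twist g1 M) \<longleftrightarrow>
            cardano_invariant \<Delta> g1 = inv\<^bsub>units_mod_cubes \<Delta>\<^esub> (cardano_invariant \<Delta> g2)) \<and>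
         ((\<exists>M :: 'a ^ 2 ^ 2. invertible M \<and> g2 = bcf_twist g1 M) \<longleftrightarrow>
            generate (units_mod_cubes \<Delta>) {cardano_invariant \<Delta> g1} =
            generate (units_mod_cubes \<Delta>) {cardano_invariant \<Delta> g2})"
proof -
  let ?Q = "units_mod_cubes \<Delta>" and ?z = "cardano_invariant \<Delta>"
  interpret Q: comm_group ?Q by (rule comm_group_units_mod_cubes)
  have "CHAR('a) \<noteq> 1" by simp
  moreover have "Factorial_Ring.prime (2::nat)" "Factorial_Ring.prime (3::nat)" by simp_all
  ultimately have "\<not> CHAR('a) dvd 2" "\<not> CHAR('a) dvd 3"
    using assms(1,2) by (metis prime_nat_iff)+
  then have two: "(2::'a) \<noteq> 0" and three: "(3::'a) \<noteq> 0"
    using of_nat_eq_0_iff_char_dvd[of 2, where ?'a = 'a] of_nat_eq_0_iff_char_dvd[of 3, where ?'a = 'a]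
    by simp_all
  note twist = cardano_invariant_twist[OF two three assms(4,3)]
  note closed = cardano_invariant_in_carrier[OF two three assms(4,3)]
    cardano_invariant_in_carrier[OF two three assms(5,3)]
  have pos: "(\<exists>M :: 'a ^ 2 ^ 2. invertible M \<and> det M = 1 \<and> g2 = bcf_twist g1 M) \<longleftrightarrow> ?z g1 = ?z g2"
  proof
    assume "?z g1 = ?z g2"
    then obtain M where "det M = 1" "g2 = bcf_twist g1 M"
      using cardano_invariant_eq_imp_twist[OF two three assms(4,5,3)] by blast
    then show "\<exists>M :: 'a ^ 2 ^ 2. invertible M \<and> det M = 1 \<and> g2 = bcf_twist g1 M"
      by (metis invertible_det_nz zero_neq_one)
  qed (auto simp: twist(1))
  have neg: "(\<exists>M :: 'a ^ 2 ^ 2. invertible M \<and> det M = - 1 \<and> g2 = bcf_twist g1 M) \<longleftrightarrow>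
      ?z g1 = inv\<^bsub>?Q\<^esub> ?z g2"
  proof
    assume inv: "?z g1 = inv\<^bsub>?Q\<^esub> ?z g2"
    \<comment> \<open>Twisting by a reflection inverts the invariant and so reduces determinant -1
      to determinant 1.\<close>
    define J :: "'a ^ 2 ^ 2" where "J = vector [vector [1, 0], vector [0, -1]]"
    have J: "det J = -1"
      by (simp add: det_2 J_def vector_2)
    have "?z (bcf_twist g1 J) = ?z g2"
      using twist(2)[OF J] inv closed by simp
    moreover have "bcf_disc (bcf_twist g1 J) = \<Delta>"
      using bcf_disc_twist[of J g1] J assms(4) by simp
    ultimately obtain M where "det M = 1" "g2 = bcf_twist (bcf_twist g1 J) M"
      using cardano_invariant_eq_imp_twist[OF two three _ assms(5,3)] by blast
    then show "\<exists>M :: 'a ^ 2 ^ 2. invertible M \<and> det M = - 1 \<and> g2 = bcf_twist g1 M"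
      by (intro exI[of _ "M ** J"]) (simp add: invertible_det_nz det_mul J bcf_twist_twist)
  qed (use closed in \<open>auto simp: twist(2)\<close>)
  \<comment> \<open>Both discriminants equal \<Delta>, which is nonzero, and the twist multiplies it
    by \<open>det M ^ 2\<close>.\<close>
  have "det M = 1 \<or> det M = -1" if "invertible M" "g2 = bcf_twist g1 M" for M :: "'a ^ 2 ^ 2"
    using bcf_disc_twist[of M g1] that assms by (auto simp: invertible_det_nz power2_eq_1_iff)
  then have "(\<exists>M :: 'a ^ 2 ^ 2. invertible M \<and> g2 = bcf_twist g1 M) \<longleftrightarrow>
      ?z g1 = ?z g2 \<or> ?z g1 = inv\<^bsub>?Q\<^esub> ?z g2"
    unfolding pos[symmetric] neg[symmetric] by blast
  then show ?thesis
    using pos neg Q.generate_singleton_eq_iff_exponent_3[OF closed units_mod_cubes_cube[OF closed(2)]]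
    by blast
qed

end
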